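(* Let $p$ be a prime, $n\ge 1$ an integer, and let $F$ be a finite field of characteristic $p$ with $q=p^n$ elements. Let $U(F[C_2^5])$ be the unit group of the group algebra $F[C_2^5]$. (1) If $p=2$, then $U(F[C_2^5])\cong C_{2}^{31n}\times C_{2^n-1}$. (2) If $p\neq 2$, then $U(F[C_2^5])\cong C_{p^n-1}^{32}$ if $q\equiv 1\pmod 2$.
   Context: $C_m$ denotes the cyclic group of order $m$, and $C_m^k$ denotes the direct product of $k$ copies of $C_m$. For a group $G$ and a field $F$, $FG$ (also written $F[G]$) is the group algebra and $U(FG)$ is the multiplicative group of all its invertible elements. *)

theory Defs
  imports "HOL-Algebra.Algebra" "HOL-Number_Theory.Cong"
begin

(* 0 if no positive multiple of the identity vanishes. *)
definition ring_char :: "('a, 'm) ring_scheme \<Rightarrow> nat" where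
  "ring_char R =
     (if \<exists>k::nat. k > 0 \<and> [k] \<cdot>\<^bsub>R\<^esub> \<one>\<^bsub>R\<^esub> = \<zero>\<^bsub>R\<^esub>
      then LEAST k::nat. k > 0 \<and> [k] \<cdot>\<^bsub>R\<^esub> \<one>\<^bsub>R\<^esub> = \<zero>\<^bsub>R\<^esub>
      else 0)"

(* The formal sum of a(g) g over g in G is encoded by its coefficient function a, which has
   finite support and is extensional (undefined off the carrier of G). The coefficient of
   x in a product is the sum of a(g) b(h) over all g, h with g h = x, that is, of
   a(g) b(g^-1 x); only g in the support of a contribute, so the sum is finite. *)
definition group_algebra ::
    "('a, 'm) ring_scheme \<Rightarrow> ('g, 'k) monoid_scheme \<Rightarrow> ('a, 'g \<Rightarrow> 'a) module" where
  "group_algebra F G =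
     \<lparr>carrier = {a \<in> carrier G \<rightarrow>\<^sub>E carrier F. finite {g \<in> carrier G. a g \<noteq> \<zero>\<^bsub>F\<^esub>}},
      monoid.mult = (\<lambda>a b. \<lambda>x\<in>carrier G.
        \<Oplus>\<^bsub>F\<^esub>g\<in>{g \<in> carrier G. a g \<noteq> \<zero>\<^bsub>F\<^esub>}. a g \<otimes>\<^bsub>F\<^esub> b (inv\<^bsub>G\<^esub> g \<otimes>\<^bsub>G\<^esub> x)),
      one = (\<lambda>x\<in>carrier G. if x = \<one>\<^bsub>G\<^esub> then \<one>\<^bsub>F\<^esub> else \<zero>\<^bsub>F\<^esub>),
      ring.zero = (\<lambda>x\<in>carrier G. \<zero>\<^bsub>F\<^esub>),
      ring.add = (\<lambda>a b. \<lambda>x\<in>carrier G. a x \<oplus>\<^bsub>F\<^esub> b x),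
      smult = (\<lambda>c a. \<lambda>x\<in>carrier G. c \<otimes>\<^bsub>F\<^esub> a x)\<rparr>"

(* C_m^k, written additively as k-tuples of residues modulo m (m > 0). *)
definition cyclic_power :: "nat \<Rightarrow> nat \<Rightarrow> (nat \<Rightarrow> int) monoid" where
  "cyclic_power m k = product_group {..<k} (\<lambda>_. integer_mod_group m)"

end

(* For odd p the 2^k sign characters of C_2^k, one for each subset S of the coordinates, evaluate
   FG into F^(2^k). Orthogonality makes this multiplicative map injective, because 2^k is
   invertible in F, and a count makes it bijective; so it identifies the units of FG with
   2^k copies of the cyclic group of nonzero elements of F.

   For p = 2 every a in FG satisfies a^2 = e(a)^2 1, where e is the augmentation. Hence a is
   a unit iff e(a) is nonzero, and dividing by e(a) splits the unit group as V x F^*, where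
   V = {e = 1} has exponent two and order q^(2^k - 1). *)

theory Submission
  imports Defs
begin

text \<open>Only the multiplicative structure of FG matters for its units, so FG is studied through
  maps to F that respect products and is never set up as a ring. The common source of these maps is
  the linear extension of a homomorphism from G to the multiplicative monoid of F. In odd
  characteristic there are |G| sign characters, enough to recover every coefficient. In
  characteristic two they all collapse to the trivial one, whose extension is the augmentation, and
  the units of augmentation 1 must be found differently. No basis of V is constructed: a finite
  group of exponent two is determined up to isomorphism by its order, so squaring and counting are
  enough. The constants come from |C_2^5| = 32: there are 32 subsets of the five coordinates, hence
  32 characters, and an element of V has 31 free coefficients, each with 2^n values.\<close>

section \<open>Isomorphism criteria, cyclic groups and the units of a finite field\<close>

lemma is_isoI_bij: "\<lbrakk>h \<in> hom G H; bij_betw h (carrier G) (carrier H)\<rbrakk> \<Longrightarrow> G \<cong> H"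
  by (auto simp: is_iso_def iso_def)

text \<open>The exponential z -> a^z survives reduction modulo |G| because the order of
  \<open>a\<close> divides |G|. It is onto since \<open>a\<close> generates, and then injective
  because both sides have |G| elements.\<close>

lemma (in group) iso_integer_mod_group:
  assumes "finite (carrier G)" "a \<in> carrier G" and gen: "carrier G = {a [^] i |i::nat. i \<in> UNIV}"
  shows "G \<cong> integer_mod_group (order G)"
proof -
  let ?Z = "integer_mod_group (order G)" and ?h = "\<lambda>z::int. a [^] z"
  have pos: "order G > 0"
    using assms(1) by (simp add: order_gt_0_iff_finite)
  have carr: "carrier ?Z = {0..<int (order G)}"
    using pos by (simp add: carrier_integer_mod_group)
  have mod_eq: "a [^] (z mod int (order G)) = a [^] z" for z :: int
  proof -
    have "int (ord a) dvd int (order G)"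
      using ord_dvd_group_order[OF assms(2)] by simp
    also have "int (order G) dvd z - z mod int (order G)"
      by (rule dvd_minus_mod)
    finally show ?thesis
      by (simp add: int_pow_eq[OF assms(2)] dvd_diff_commute)
  qed
  have hom: "?h \<in> hom ?Z G"
    by (rule homI) (simp_all add: assms(2) mod_eq int_pow_mult)
  have surj: "?h ` carrier ?Z = carrier G"
  proof
    show "?h ` carrier ?Z \<subseteq> carrier G"
      using assms(2) by auto
    show "carrier G \<subseteq> ?h ` carrier ?Z"
    proof
      fix x assume "x \<in> carrier G"
      then obtain i :: nat where "x = a [^] i"
        using gen by blast
      then have "x = ?h (int i mod int (order G))"
        by (simp only: mod_eq int_pow_int)
      then show "x \<in> ?h ` carrier ?Z"
        using pos by (auto simp: carr)
    qed
  qed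
  have "inj_on ?h (carrier ?Z)"
  proof (rule eq_card_imp_inj_on)
    show "finite (carrier ?Z)"
      by (simp add: carr)
    show "card (?h ` carrier ?Z) = card (carrier ?Z)"
      unfolding surj by (simp add: carr) (simp add: order_def)
  qed
  with surj have "?Z \<cong> G"
    by (intro is_isoI_bij[OF hom]) (simp add: bij_betw_def)
  then show ?thesis
    by (simp add: group.iso_sym)
qed

lemma (in field) units_iso_integer_mod_group:
  assumes "finite (carrier R)"
  shows "units_of R \<cong> integer_mod_group (order R - 1)"
proof -
  interpret U: group "units_of R"
    by (rule units_group)
  obtain a where "a \<in> carrier (Multiplicative_Group.mult_of R)"
    and "carrier (Multiplicative_Group.mult_of R) = {a [^] i |i::nat. i \<in> UNIV}"
    using finite_field_mult_group_has_gen[OF assms] by blast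
  \<comment> \<open>The generator is obtained in \<open>mult_of R\<close>, with powers taken in
    \<open>R\<close>; over a field this is the same group as \<open>units_of R\<close>.\<close>
  then have a: "a \<in> carrier (units_of R)"
    and gen: "carrier (units_of R) = {a [^]\<^bsub>units_of R\<^esub> i |i::nat. i \<in> UNIV}"
    by (simp_all only: Multiplicative_Group.nat_pow_mult_of flip: Multiplicative_Group.field.mult_of_is_Units[OF field_axioms])
  have fin: "finite (carrier (units_of R))"
    using assms by (simp add: units_of_carrier field_Units)
  have "order (units_of R) = order R - 1"
    using assms by (simp add: order_def units_of_carrier field_Units card_Diff_singleton)
  with U.iso_integer_mod_group[OF fin a gen] show ?thesis
    by simp
qed

lemma product_group_iso:
  assumes "\<And>i. i \<in> I \<Longrightarrow> G i \<cong> H i"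
  shows "product_group I G \<cong> product_group I H"
proof -
  have "\<exists>h. h \<in> iso (G i) (H i)" if "i \<in> I" for i
    using assms[OF that] by (auto simp: is_iso_def)
  then obtain h where h: "\<And>i. i \<in> I \<Longrightarrow> h i \<in> iso (G i) (H i)"
    by metis
  have "(\<lambda>x. \<lambda>i\<in>I. h i (x i)) \<in> hom (product_group I G) (product_group I H)"
  proof (rule homI)
    have hom: "h i \<in> hom (G i) (H i)" if "i \<in> I" for i
      using h[OF that] by (simp add: iso_def)
    show "(\<lambda>i\<in>I. h i (x i)) \<in> carrier (product_group I H)" if "x \<in> carrier (product_group I G)" for x
      using that by (auto simp: PiE_iff intro: hom_in_carrier[OF hom])
    show "(\<lambda>i\<in>I. h i ((x \<otimes>\<^bsub>product_group I G\<^esub> y) i)) =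
        (\<lambda>i\<in>I. h i (x i)) \<otimes>\<^bsub>product_group I H\<^esub> (\<lambda>i\<in>I. h i (y i))"
      if "x \<in> carrier (product_group I G)" "y \<in> carrier (product_group I G)" for x y
      using that by (auto simp: PiE_iff hom_mult[OF hom] intro: restrict_ext)
  qed
  moreover have "bij_betw (\<lambda>x. \<lambda>i\<in>I. h i (x i)) (\<Pi>\<^sub>E i\<in>I. carrier (G i)) (\<Pi>\<^sub>E i\<in>I. carrier (H i))"
  proof (rule bij_betw_byWitness[where f' = "\<lambda>y. \<lambda>i\<in>I. inv_into (carrier (G i)) (h i) (y i)"])
    have bij: "bij_betw (h i) (carrier (G i)) (carrier (H i))" if "i \<in> I" for i
      using h[OF that] by (simp add: iso_def)
    show "\<forall>x\<in>\<Pi>\<^sub>E i\<in>I. carrier (G i).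
        (\<lambda>i\<in>I. inv_into (carrier (G i)) (h i) ((\<lambda>i\<in>I. h i (x i)) i)) = x"
      using bij by (auto simp: PiE_iff bij_betw_inv_into_left[OF bij] extensional_def fun_eq_iff)
    show "\<forall>y\<in>\<Pi>\<^sub>E i\<in>I. carrier (H i).
        (\<lambda>i\<in>I. h i ((\<lambda>i\<in>I. inv_into (carrier (G i)) (h i) (y i)) i)) = y"
      using bij by (auto simp: PiE_iff bij_betw_inv_into_right[OF bij] extensional_def fun_eq_iff)
    show "(\<lambda>x. \<lambda>i\<in>I. h i (x i)) ` (\<Pi>\<^sub>E i\<in>I. carrier (G i)) \<subseteq> (\<Pi>\<^sub>E i\<in>I. carrier (H i))"
      by (clarsimp simp: PiE_iff) (metis bij bij_betw_apply)
    show "(\<lambda>y. \<lambda>i\<in>I. inv_into (carrier (G i)) (h i) (y i)) ` (\<Pi>\<^sub>E i\<in>I. carrier (H i))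
        \<subseteq> (\<Pi>\<^sub>E i\<in>I. carrier (G i))"
      by (clarsimp simp: PiE_iff) (metis bij bij_betw_apply bij_betw_inv_into)
  qed
  ultimately show ?thesis
    by (simp add: is_isoI_bij)
qed

section \<open>Powers of cyclic groups and finite groups of exponent two\<close>

lemma group_cyclic_power: "group (cyclic_power m k)"
  by (simp add: cyclic_power_def)

lemma carrier_cyclic_power:
  "m > 0 \<Longrightarrow> carrier (cyclic_power m k) = {..<k} \<rightarrow>\<^sub>E {0..<int m}"
  by (simp add: cyclic_power_def carrier_integer_mod_group)

lemma mult_cyclic_power: "x \<otimes>\<^bsub>cyclic_power m k\<^esub> y = (\<lambda>i\<in>{..<k}. (x i + y i) mod int m)"
  by (simp add: cyclic_power_def)

lemma one_cyclic_power: "\<one>\<^bsub>cyclic_power m k\<^esub> = (\<lambda>i\<in>{..<k}. 0)"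
  by (simp add: cyclic_power_def)

lemma finite_cyclic_power: "m > 0 \<Longrightarrow> finite (carrier (cyclic_power m k))"
  by (simp add: carrier_cyclic_power finite_PiE)

lemma order_cyclic_power: "m > 0 \<Longrightarrow> order (cyclic_power m k) = m ^ k"
  by (simp add: order_def carrier_cyclic_power card_PiE)

lemma cyclic_power_2_square:
  "x \<otimes>\<^bsub>cyclic_power 2 k\<^esub> x = \<one>\<^bsub>cyclic_power 2 k\<^esub>"
  unfolding mult_cyclic_power one_cyclic_power by (rule restrict_ext) simp

text \<open>Every element is its own inverse, so xy = (xy)^-1 = y^-1 x^-1 = yx.\<close>

lemma (in group) exponent_two_comm:
  assumes sq: "\<And>x. x \<in> carrier G \<Longrightarrow> x \<otimes> x = \<one>" and "x \<in> carrier G" "y \<in> carrier G"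
  shows "x \<otimes> y = y \<otimes> x"
proof -
  have "inv z = z" if "z \<in> carrier G" for z
    by (rule inv_equality) (use sq that in simp_all)
  then show ?thesis
    using inv_mult_group[OF assms(2,3)] assms(2,3) by simp
qed

text \<open>An element outside the image of an embedding of \<open>C_2^k\<close> extends it to one of \<open>C_2^(k+1)\<close>.\<close>

lemma (in group) exponent_two_embedding:
  assumes sq: "\<And>x. x \<in> carrier G \<Longrightarrow> x \<otimes> x = \<one>" and ord: "order G = 2 ^ m"
  shows "k \<le> m \<Longrightarrow> \<exists>h \<in> hom (cyclic_power 2 k) G. inj_on h (carrier (cyclic_power 2 k))"
proof (induction k)
  case 0
  have "(\<lambda>_. \<one>) \<in> hom (cyclic_power 2 0) G"
    by (simp add: hom_def)
  moreover have "inj_on (\<lambda>_. \<one>) (carrier (cyclic_power 2 0))"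
    by (simp add: carrier_cyclic_power)
  ultimately show ?case by blast
next
  case (Suc k)
  let ?C = "cyclic_power 2 k" and ?D = "cyclic_power 2 (Suc k)"
  interpret comm_group G
    by (rule group_comm_groupI) (simp add: exponent_two_comm sq)
  obtain h where h: "h \<in> hom ?C G" and inj: "inj_on h (carrier ?C)"
    using Suc by auto
  have hC: "h x \<in> carrier G" if "x \<in> carrier ?C" for x
    using h that by (auto simp: hom_def)
  \<comment> \<open>Since k < m, the image has 2^k < 2^m elements and cannot fill the group; this
    provides the new generator \<open>g\<close>.\<close>
  have "card (h ` carrier ?C) = 2 ^ k"
    using card_image[OF inj] order_cyclic_power[of 2 k] by (simp add: order_def)
  also have "\<dots> < card (carrier G)"
    using Suc.prems ord by (simp add: order_def)
  finally have "h ` carrier ?C \<noteq> carrier G" by auto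
  then obtain g where g: "g \<in> carrier G" "g \<notin> h ` carrier ?C"
    using hC by blast
  define r where "r x = restrict x {..<k}" for x :: "nat \<Rightarrow> int"
  \<comment> \<open>The new coordinate decides whether \<open>g\<close> is multiplied in, so the
    last basis vector of C_2^(k+1) goes to \<open>g\<close> and the others go where \<open>h\<close>
    sends them.\<close>
  define h' where "h' x = h (r x) \<otimes> (if x k = 1 then g else \<one>)" for x
  have r: "r x \<in> carrier ?C" if "x \<in> carrier ?D" for x
    using that by (auto simp: carrier_cyclic_power r_def PiE_iff)
  have xk: "x k = 0 \<or> x k = 1" if "x \<in> carrier ?D" for x
  proof -
    have "x k \<in> {0..<2}"
      using that by (auto simp: carrier_cyclic_power PiE_iff)
    then show ?thesis by auto
  qed
  have r_mult: "r (x \<otimes>\<^bsub>?D\<^esub> y) = r x \<otimes>\<^bsub>?C\<^esub> r y" for x y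
    by (auto simp: r_def mult_cyclic_power fun_eq_iff)
  have hr_mult: "h (r (x \<otimes>\<^bsub>?D\<^esub> y)) = h (r x) \<otimes> h (r y)" if "x \<in> carrier ?D" "y \<in> carrier ?D" for x y
    using h r that by (simp add: r_mult hom_mult)
  have gg: "g \<otimes> (g \<otimes> z) = z" if "z \<in> carrier G" for z
    using g that sq by (simp flip: m_assoc)
  have hom: "h' \<in> hom ?D G"
  proof (rule homI)
    show "h' x \<in> carrier G" if "x \<in> carrier ?D" for x
      using g hC r[OF that] by (simp add: h'_def)
    show "h' (x \<otimes>\<^bsub>?D\<^esub> y) = h' x \<otimes> h' y" if xy: "x \<in> carrier ?D" "y \<in> carrier ?D" for x y
    proof -
      have k: "(x \<otimes>\<^bsub>?D\<^esub> y) k = (x k + y k) mod 2"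
        by (simp add: mult_cyclic_power)
      have c: "h (r x) \<in> carrier G" "h (r y) \<in> carrier G"
        using xy hC r by auto
      \<comment> \<open>When both last coordinates are 1, the two factors \<open>g\<close> cancel,
        matching 1 + 1 = 0 modulo 2.\<close>
      have *: "h (r x) \<otimes> g \<otimes> (h (r y) \<otimes> g) = h (r x) \<otimes> h (r y)"
        using c g by (simp add: m_ac gg)
      show ?thesis
        using xk[OF xy(1)] xk[OF xy(2)] c g
        unfolding h'_def k hr_mult[OF xy]
        by (elim disjE) (simp_all add: *, simp_all add: m_ac)
    qed
  qed
  have "inj_on h' (carrier ?D)"
  proof (rule inj_onI)
    fix x y assume xy: "x \<in> carrier ?D" "y \<in> carrier ?D" and eq: "h' x = h' y"
    have c: "h (r x) \<in> carrier G" "h (r y) \<in> carrier G"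
      using xy hC r by auto
    \<comment> \<open>A collision between elements with different last coordinates would express
      \<open>g\<close> as a product of two values of \<open>h\<close>, which lies in the image of
      \<open>h\<close>, contrary to the choice of \<open>g\<close>.\<close>
    have no: False if zw: "z \<in> carrier ?D" "w \<in> carrier ?D" and e: "h (r z) \<otimes> g = h (r w)" for z w
    proof -
      have "h (r z \<otimes>\<^bsub>?C\<^esub> r w) = h (r z) \<otimes> h (r w)"
        using h r zw by (simp add: hom_mult)
      also have "\<dots> = (h (r z) \<otimes> h (r z)) \<otimes> g"
        using g hC r zw by (simp flip: e add: m_assoc)
      also have "\<dots> = g"
        using g hC r zw by (simp add: sq)
      finally have "g \<in> h ` carrier ?C"
        using r zw group.is_monoid[OF group_cyclic_power]
        by (metis image_eqI monoid.m_closed)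
      then show False using g by simp
    qed
    have "x k = y k \<and> h (r x) = h (r y)"
      using xk[OF xy(1)] xk[OF xy(2)] eq c g no[OF xy] no[OF xy(2,1)]
      by (elim disjE) (auto simp: h'_def)
    then have "x k = y k" "r x = r y"
      using inj r xy by (auto dest: inj_onD)
    then have "x i = y i" if "i < Suc k" for i
      using that by (metis less_Suc_eq lessThan_iff r_def restrict_apply')
    then show "x = y"
      using xy by (intro PiE_ext[of x "{..<Suc k}" _ y]) (auto simp: carrier_cyclic_power)
  qed
  with hom show ?case by blast
qed

text \<open>At k = m the embedding has as many values as the group has elements, so it is onto. This
  takes the place of choosing a basis over the field with two elements.\<close>

lemma (in group) exponent_two_iso:
  assumes "\<And>x. x \<in> carrier G \<Longrightarrow> x \<otimes> x = \<one>" and ord: "order G = 2 ^ m"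
  shows "G \<cong> cyclic_power 2 m"
proof -
  obtain h where h: "h \<in> hom (cyclic_power 2 m) G" and inj: "inj_on h (carrier (cyclic_power 2 m))"
    using exponent_two_embedding[OF assms, of m] by auto
  \<comment> \<open>An infinite carrier would have \<open>order\<close> 0, which is not a power of
    two.\<close>
  have "finite (carrier G)"
    using ord order_gt_0_iff_finite by fastforce
  moreover have "h ` carrier (cyclic_power 2 m) \<subseteq> carrier G"
    using h by (auto simp: hom_def)
  moreover have "card (h ` carrier (cyclic_power 2 m)) = card (carrier G)"
    using card_image[OF inj] order_cyclic_power[of 2 m] ord by (simp add: order_def)
  ultimately have "h ` carrier (cyclic_power 2 m) = carrier G"
    by (rule card_subset_eq)
  then have "cyclic_power 2 m \<cong> G"
    using is_isoI_bij[OF h] inj by (simp add: bij_betw_def)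
  then show ?thesis
    by (simp add: group.iso_sym group_cyclic_power)
qed

subsection \<open>Group algebras of finite groups\<close>

lemma (in abelian_monoid) finsum_swap:
  assumes "finite A" "finite B" and f: "\<And>i j. \<lbrakk>i \<in> A; j \<in> B\<rbrakk> \<Longrightarrow> f i j \<in> carrier G"
  shows "(\<Oplus>i\<in>A. \<Oplus>j\<in>B. f i j) = (\<Oplus>j\<in>B. \<Oplus>i\<in>A. f i j)"
  using assms(1) f
proof (induction A rule: finite_induct)
  case empty
  then show ?case by simp
next
  case (insert a A)
  have "(\<Oplus>j\<in>B. \<Oplus>i\<in>insert a A. f i j) = (\<Oplus>j\<in>B. f a j \<oplus> (\<Oplus>i\<in>A. f i j))"
    using insert by (intro finsum_cong' refl) (auto intro!: finsum_closed)
  also have "\<dots> = (\<Oplus>j\<in>B. f a j) \<oplus> (\<Oplus>j\<in>B. \<Oplus>i\<in>A. f i j)"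
    using insert by (intro finsum_addf) (auto intro!: finsum_closed)
  also have "\<dots> = (\<Oplus>i\<in>insert a A. \<Oplus>j\<in>B. f i j)"
    using insert by (subst finsum_insert) (auto intro!: finsum_closed)
  finally show ?case ..
qed

lemma (in abelian_monoid) finsum_bij_betw:
  assumes "bij_betw h A B" "\<And>x. x \<in> B \<Longrightarrow> f x \<in> carrier G"
  shows "(\<Oplus>x\<in>A. f (h x)) = (\<Oplus>x\<in>B. f x)"
  using finsum_reindex[of f h A] assms by (auto simp: bij_betw_def)

locale finite_group_algebra = cring R + G: group G for R (structure) and G +
  assumes finite_G: "finite (carrier G)"
begin

abbreviation "FG \<equiv> group_algebra R G"

text \<open>The linear extension to FG of a map on G. One construction serves both characteristics:
  sign characters give the evaluations in the odd case, the constant map 1 gives the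
  augmentation.\<close>

definition lin_ext where
  "lin_ext \<chi> a = (\<Oplus>x\<in>carrier G. a x \<otimes> \<chi> x)"

abbreviation "aug \<equiv> lin_ext (\<lambda>_. \<one>)"

lemma carrier_FG: "carrier FG = carrier G \<rightarrow>\<^sub>E carrier R"
  using finite_G by (auto simp: group_algebra_def)

lemma FG_ext:
  assumes "a \<in> carrier FG" "b \<in> carrier FG" "\<And>x. x \<in> carrier G \<Longrightarrow> a x = b x"
  shows "a = b"
  using assms by (auto simp: carrier_FG intro: PiE_ext)

lemma FG_closed [simp]: "\<lbrakk>a \<in> carrier FG; x \<in> carrier G\<rbrakk> \<Longrightarrow> a x \<in> carrier R"
  by (auto simp: carrier_FG)

lemma one_FG: "x \<in> carrier G \<Longrightarrow> \<one>\<^bsub>FG\<^esub> x = (if x = \<one>\<^bsub>G\<^esub> then \<one> else \<zero>)"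
  by (simp add: group_algebra_def)

lemma smult_FG: "x \<in> carrier G \<Longrightarrow> (c \<odot>\<^bsub>FG\<^esub> a) x = c \<otimes> a x"
  by (simp add: group_algebra_def)

text \<open>Elements outside the support of \<open>a\<close> contribute zero. Summing over all of G
  frees the index set from \<open>a\<close>, so that sums can be exchanged and translated.\<close>

lemma mult_FG:
  assumes "a \<in> carrier FG" "b \<in> carrier FG" "x \<in> carrier G"
  shows "(a \<otimes>\<^bsub>FG\<^esub> b) x = (\<Oplus>g\<in>carrier G. a g \<otimes> b (inv\<^bsub>G\<^esub> g \<otimes>\<^bsub>G\<^esub> x))"
proof -
  have "(a \<otimes>\<^bsub>FG\<^esub> b) x = (\<Oplus>g\<in>{g \<in> carrier G. a g \<noteq> \<zero>}. a g \<otimes> b (inv\<^bsub>G\<^esub> g \<otimes>\<^bsub>G\<^esub> x))"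
    using assms by (simp add: group_algebra_def)
  also have "\<dots> = (\<Oplus>g\<in>carrier G. a g \<otimes> b (inv\<^bsub>G\<^esub> g \<otimes>\<^bsub>G\<^esub> x))"
    by (rule add.finprod_mono_neutral_cong_left) (use finite_G assms in auto)
  finally show ?thesis .
qed

lemma mult_FG_closed [simp]:
  assumes "a \<in> carrier FG" "b \<in> carrier FG"
  shows "a \<otimes>\<^bsub>FG\<^esub> b \<in> carrier FG"
proof -
  have "a \<otimes>\<^bsub>FG\<^esub> b \<in> extensional (carrier G)"
    by (simp add: group_algebra_def)
  moreover have "(a \<otimes>\<^bsub>FG\<^esub> b) x \<in> carrier R" if "x \<in> carrier G" for x
    using assms that by (auto simp: mult_FG intro!: finsum_closed)
  ultimately show ?thesis
    by (simp add: carrier_FG PiE_iff)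
qed

lemma one_FG_closed [simp]: "\<one>\<^bsub>FG\<^esub> \<in> carrier FG"
  by (simp add: carrier_FG PiE_iff one_FG, simp add: group_algebra_def)

lemma smult_FG_closed [simp]: "\<lbrakk>c \<in> carrier R; a \<in> carrier FG\<rbrakk> \<Longrightarrow> c \<odot>\<^bsub>FG\<^esub> a \<in> carrier FG"
  by (simp add: carrier_FG PiE_iff, simp add: group_algebra_def)

lemma finsum_one_FG:
  assumes "f \<in> carrier G \<rightarrow> carrier R"
  shows "(\<Oplus>g\<in>carrier G. \<one>\<^bsub>FG\<^esub> g \<otimes> f g) = f \<one>\<^bsub>G\<^esub>"
proof -
  have "(\<Oplus>g\<in>carrier G. \<one>\<^bsub>FG\<^esub> g \<otimes> f g) = (\<Oplus>g\<in>carrier G. if g = \<one>\<^bsub>G\<^esub> then f g else \<zero>)"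
    using assms by (intro finsum_cong' refl) (auto simp: one_FG Pi_def)
  then show ?thesis
    using add.finprod_singleton_swap[OF G.one_closed finite_G assms] by simp
qed

lemma l_one_FG:
  assumes "a \<in> carrier FG"
  shows "\<one>\<^bsub>FG\<^esub> \<otimes>\<^bsub>FG\<^esub> a = a"
proof (rule FG_ext)
  fix x assume "x \<in> carrier G"
  then show "(\<one>\<^bsub>FG\<^esub> \<otimes>\<^bsub>FG\<^esub> a) x = a x"
    using assms finsum_one_FG[of "\<lambda>g. a (inv\<^bsub>G\<^esub> g \<otimes>\<^bsub>G\<^esub> x)"] by (simp add: mult_FG Pi_def)
qed (use assms in simp_all)

lemma left_translation_bij:
  assumes "g \<in> carrier G"
  shows "bij_betw (\<lambda>x. g \<otimes>\<^bsub>G\<^esub> x) (carrier G) (carrier G)"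
  using assms by (auto simp: bij_betw_def G.inj_on_cmult G.surj_const_mult)

text \<open>Both sides are the double sum over h and g of a(h) b(h^-1 g) c(g^-1 x). Exchanging the
  sums and substituting hg for g turns the inner sum into the coefficient of bc at h^-1 x.\<close>

lemma assoc_FG:
  assumes "a \<in> carrier FG" "b \<in> carrier FG" "c \<in> carrier FG"
  shows "a \<otimes>\<^bsub>FG\<^esub> b \<otimes>\<^bsub>FG\<^esub> c = a \<otimes>\<^bsub>FG\<^esub> (b \<otimes>\<^bsub>FG\<^esub> c)"
proof (rule FG_ext)
  fix x assume x: "x \<in> carrier G"
  let ?t = "\<lambda>h g. a h \<otimes> (b (inv\<^bsub>G\<^esub> h \<otimes>\<^bsub>G\<^esub> g) \<otimes> c (inv\<^bsub>G\<^esub> g \<otimes>\<^bsub>G\<^esub> x))"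
  have inner: "(\<Oplus>g\<in>carrier G. ?t h g) = a h \<otimes> (b \<otimes>\<^bsub>FG\<^esub> c) (inv\<^bsub>G\<^esub> h \<otimes>\<^bsub>G\<^esub> x)"
    if h: "h \<in> carrier G" for h
  proof -
    have "(\<Oplus>g\<in>carrier G. ?t h g) = (\<Oplus>g\<in>carrier G. ?t h (h \<otimes>\<^bsub>G\<^esub> g))"
      by (rule finsum_bij_betw[OF left_translation_bij[OF h], symmetric]) (use assms x h in simp)
    also have "\<dots> = (\<Oplus>g\<in>carrier G. a h \<otimes> (b g \<otimes> c (inv\<^bsub>G\<^esub> g \<otimes>\<^bsub>G\<^esub> (inv\<^bsub>G\<^esub> h \<otimes>\<^bsub>G\<^esub> x))))"
      using assms x h
      by (intro finsum_cong' refl)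
        (auto simp: G.inv_mult_group G.m_assoc simp flip: G.m_assoc[of "inv\<^bsub>G\<^esub> h"])
    also have "\<dots> = a h \<otimes> (b \<otimes>\<^bsub>FG\<^esub> c) (inv\<^bsub>G\<^esub> h \<otimes>\<^bsub>G\<^esub> x)"
      using assms x h by (simp add: mult_FG finsum_rdistr finite_G Pi_def)
    finally show ?thesis .
  qed
  have "(a \<otimes>\<^bsub>FG\<^esub> b \<otimes>\<^bsub>FG\<^esub> c) x = (\<Oplus>g\<in>carrier G. \<Oplus>h\<in>carrier G. ?t h g)"
    using assms x by (auto simp: mult_FG finsum_ldistr finite_G Pi_def m_assoc
        intro!: finsum_cong' finsum_closed)
  also have "\<dots> = (\<Oplus>h\<in>carrier G. \<Oplus>g\<in>carrier G. ?t h g)"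
    using assms x by (intro finsum_swap finite_G) simp
  also have "\<dots> = (\<Oplus>h\<in>carrier G. a h \<otimes> (b \<otimes>\<^bsub>FG\<^esub> c) (inv\<^bsub>G\<^esub> h \<otimes>\<^bsub>G\<^esub> x))"
    using assms x by (intro finsum_cong' refl) (auto simp: inner)
  also have "\<dots> = (a \<otimes>\<^bsub>FG\<^esub> (b \<otimes>\<^bsub>FG\<^esub> c)) x"
    using assms x by (simp add: mult_FG[of a])
  finally show "(a \<otimes>\<^bsub>FG\<^esub> b \<otimes>\<^bsub>FG\<^esub> c) x = (a \<otimes>\<^bsub>FG\<^esub> (b \<otimes>\<^bsub>FG\<^esub> c)) x" .
qed (use assms in simp_all)

lemma smult_mult_FG:
  assumes "c \<in> carrier R" "a \<in> carrier FG" "b \<in> carrier FG"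
  shows "(c \<odot>\<^bsub>FG\<^esub> a) \<otimes>\<^bsub>FG\<^esub> b = c \<odot>\<^bsub>FG\<^esub> (a \<otimes>\<^bsub>FG\<^esub> b)"
    and "a \<otimes>\<^bsub>FG\<^esub> (c \<odot>\<^bsub>FG\<^esub> b) = c \<odot>\<^bsub>FG\<^esub> (a \<otimes>\<^bsub>FG\<^esub> b)"
proof -
  have *: "(c \<odot>\<^bsub>FG\<^esub> (a \<otimes>\<^bsub>FG\<^esub> b)) x = (\<Oplus>g\<in>carrier G. c \<otimes> (a g \<otimes> b (inv\<^bsub>G\<^esub> g \<otimes>\<^bsub>G\<^esub> x)))"
    if x: "x \<in> carrier G" for x
  proof -
    have "(c \<odot>\<^bsub>FG\<^esub> (a \<otimes>\<^bsub>FG\<^esub> b)) x = c \<otimes> (\<Oplus>g\<in>carrier G. a g \<otimes> b (inv\<^bsub>G\<^esub> g \<otimes>\<^bsub>G\<^esub> x))"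
      using assms x by (simp add: mult_FG smult_FG)
    also have "\<dots> = (\<Oplus>g\<in>carrier G. c \<otimes> (a g \<otimes> b (inv\<^bsub>G\<^esub> g \<otimes>\<^bsub>G\<^esub> x)))"
      using assms x by (intro finsum_rdistr finite_G) auto
    finally show ?thesis .
  qed
  have 1: "((c \<odot>\<^bsub>FG\<^esub> a) \<otimes>\<^bsub>FG\<^esub> b) x = (c \<odot>\<^bsub>FG\<^esub> (a \<otimes>\<^bsub>FG\<^esub> b)) x" if x: "x \<in> carrier G" for x
    unfolding *[OF x] using assms x
    by (subst mult_FG) (auto simp: smult_FG m_assoc intro!: finsum_cong')
  have 2: "(a \<otimes>\<^bsub>FG\<^esub> (c \<odot>\<^bsub>FG\<^esub> b)) x = (c \<odot>\<^bsub>FG\<^esub> (a \<otimes>\<^bsub>FG\<^esub> b)) x" if x: "x \<in> carrier G" for x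
    unfolding *[OF x] using assms x
    by (subst mult_FG) (auto simp: smult_FG m_lcomm intro!: finsum_cong')
  show "(c \<odot>\<^bsub>FG\<^esub> a) \<otimes>\<^bsub>FG\<^esub> b = c \<odot>\<^bsub>FG\<^esub> (a \<otimes>\<^bsub>FG\<^esub> b)"
    by (rule FG_ext) (use assms 1 in simp_all)
  show "a \<otimes>\<^bsub>FG\<^esub> (c \<odot>\<^bsub>FG\<^esub> b) = c \<odot>\<^bsub>FG\<^esub> (a \<otimes>\<^bsub>FG\<^esub> b)"
    by (rule FG_ext) (use assms 2 in simp_all)
qed

lemma smult_smult_FG:
  assumes "c \<in> carrier R" "d \<in> carrier R" "a \<in> carrier FG"
  shows "c \<odot>\<^bsub>FG\<^esub> (d \<odot>\<^bsub>FG\<^esub> a) = (c \<otimes> d) \<odot>\<^bsub>FG\<^esub> a"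
  by (rule FG_ext) (use assms in \<open>simp_all add: smult_FG m_assoc\<close>)

lemma smult_one_FG:
  assumes "a \<in> carrier FG"
  shows "\<one> \<odot>\<^bsub>FG\<^esub> a = a"
  by (rule FG_ext) (use assms in \<open>simp_all add: smult_FG\<close>)

lemma lin_ext_closed [simp]:
  "\<lbrakk>a \<in> carrier FG; \<chi> \<in> carrier G \<rightarrow> carrier R\<rbrakk> \<Longrightarrow> lin_ext \<chi> a \<in> carrier R"
  unfolding lin_ext_def by (rule finsum_closed) auto

lemma lin_ext_one:
  assumes "\<chi> \<in> carrier G \<rightarrow> carrier R"
  shows "lin_ext \<chi> \<one>\<^bsub>FG\<^esub> = \<chi> \<one>\<^bsub>G\<^esub>"
  using finsum_one_FG[OF assms] by (simp add: lin_ext_def)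

lemma lin_ext_smult:
  assumes "c \<in> carrier R" "a \<in> carrier FG" "\<chi> \<in> carrier G \<rightarrow> carrier R"
  shows "lin_ext \<chi> (c \<odot>\<^bsub>FG\<^esub> a) = c \<otimes> lin_ext \<chi> a"
proof -
  have "c \<otimes> lin_ext \<chi> a = (\<Oplus>x\<in>carrier G. c \<otimes> (a x \<otimes> \<chi> x))"
    unfolding lin_ext_def using assms by (intro finsum_rdistr finite_G) auto
  also have "\<dots> = lin_ext \<chi> (c \<odot>\<^bsub>FG\<^esub> a)"
    unfolding lin_ext_def using assms by (intro finsum_cong' refl) (auto simp: smult_FG m_assoc Pi_def)
  finally show ?thesis ..
qed

text \<open>After exchanging the sums and replacing x by gx, the factor chi(gx) = chi(g) chi(x)
  separates the double sum into a product.\<close>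

lemma lin_ext_mult:
  assumes "a \<in> carrier FG" "b \<in> carrier FG" and \<chi>: "\<And>x. x \<in> carrier G \<Longrightarrow> \<chi> x \<in> carrier R"
    and mult: "\<And>x y. \<lbrakk>x \<in> carrier G; y \<in> carrier G\<rbrakk> \<Longrightarrow> \<chi> (x \<otimes>\<^bsub>G\<^esub> y) = \<chi> x \<otimes> \<chi> y"
  shows "lin_ext \<chi> (a \<otimes>\<^bsub>FG\<^esub> b) = lin_ext \<chi> a \<otimes> lin_ext \<chi> b"
proof -
  let ?t = "\<lambda>g x. a g \<otimes> b (inv\<^bsub>G\<^esub> g \<otimes>\<^bsub>G\<^esub> x) \<otimes> \<chi> x"
  have inner: "(\<Oplus>x\<in>carrier G. ?t g x) = a g \<otimes> \<chi> g \<otimes> lin_ext \<chi> b" if g: "g \<in> carrier G" for g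
  proof -
    have "(\<Oplus>x\<in>carrier G. ?t g x) = (\<Oplus>x\<in>carrier G. ?t g (g \<otimes>\<^bsub>G\<^esub> x))"
      by (rule finsum_bij_betw[OF left_translation_bij[OF g], symmetric]) (use assms g in simp)
    also have "\<dots> = (\<Oplus>x\<in>carrier G. (a g \<otimes> \<chi> g) \<otimes> (b x \<otimes> \<chi> x))"
      using assms g
      by (intro finsum_cong' refl)
        (auto simp: m_ac simp flip: G.m_assoc)
    also have "\<dots> = a g \<otimes> \<chi> g \<otimes> lin_ext \<chi> b"
      unfolding lin_ext_def using assms g by (intro finsum_rdistr[symmetric] finite_G) auto
    finally show ?thesis .
  qed
  have c: "lin_ext \<chi> b \<in> carrier R"
    using assms by (intro lin_ext_closed) auto
  have "lin_ext \<chi> (a \<otimes>\<^bsub>FG\<^esub> b) = (\<Oplus>x\<in>carrier G. \<Oplus>g\<in>carrier G. ?t g x)"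
    unfolding lin_ext_def using assms by (auto simp: mult_FG finsum_ldistr finite_G Pi_def
        intro!: finsum_cong' finsum_closed)
  also have "\<dots> = (\<Oplus>g\<in>carrier G. \<Oplus>x\<in>carrier G. ?t g x)"
    using assms by (intro finsum_swap finite_G) simp
  also have "\<dots> = (\<Oplus>g\<in>carrier G. a g \<otimes> \<chi> g \<otimes> lin_ext \<chi> b)"
    using assms c by (intro finsum_cong' refl) (auto simp: inner)
  also have "\<dots> = lin_ext \<chi> a \<otimes> lin_ext \<chi> b"
    unfolding lin_ext_def[of \<chi> a] using assms c
    by (intro finsum_ldistr[symmetric] finite_G) auto
  finally show ?thesis .
qed

end

subsection \<open>Characters of elementary abelian 2-groups\<close>

context finite_group_algebra begin

text \<open>Abstract Fourier transform: besides multiplicativity, what is asked of the characters is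
  that their sum at each fixed x other than the identity vanishes. That is the form of orthogonality
  which recovers coefficients from character values.\<close>

lemma units_iso_product_of_characters:
  assumes finR: "finite (carrier R)" and N: "N = order G" and unit: "[N] \<cdot> \<one> \<in> Units R"
    and \<chi>: "\<And>j x. \<lbrakk>j < N; x \<in> carrier G\<rbrakk> \<Longrightarrow> \<chi> j x \<in> carrier R"
    and \<chi>_mult: "\<And>j x y. \<lbrakk>j < N; x \<in> carrier G; y \<in> carrier G\<rbrakk>
                   \<Longrightarrow> \<chi> j (x \<otimes>\<^bsub>G\<^esub> y) = \<chi> j x \<otimes> \<chi> j y"
    and \<chi>_one: "\<And>j. j < N \<Longrightarrow> \<chi> j \<one>\<^bsub>G\<^esub> = \<one>"
    and orth: "\<And>x. \<lbrakk>x \<in> carrier G; x \<noteq> \<one>\<^bsub>G\<^esub>\<rbrakk> \<Longrightarrow> (\<Oplus>j\<in>{..<N}. \<chi> j x) = \<zero>"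
  shows "units_of FG \<cong> product_group {..<N} (\<lambda>_. units_of R)"
proof -
  let ?J = "{..<N}"
  define \<Phi> where "\<Phi> a = (\<lambda>j\<in>?J. lin_ext (\<chi> j) a)" for a
  have closed: "lin_ext (\<chi> j) a \<in> carrier R" if "a \<in> carrier FG" "j < N" for a j
    using that \<chi> by auto
  have mult: "lin_ext (\<chi> j) (a \<otimes>\<^bsub>FG\<^esub> b) = lin_ext (\<chi> j) a \<otimes> lin_ext (\<chi> j) b"
    if "a \<in> carrier FG" "b \<in> carrier FG" "j < N" for a b j
    using that \<chi> \<chi>_mult by (intro lin_ext_mult) auto
  have one: "lin_ext (\<chi> j) \<one>\<^bsub>FG\<^esub> = \<one>" if "j < N" for j
    using that \<chi> \<chi>_one by (subst lin_ext_one) auto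
  \<comment> \<open>Fourier inversion: in the exchanged double sum the term at x carries the
    character sum at y^-1 x, which is N for x = y and zero otherwise.\<close>
  have inversion: "(\<Oplus>j\<in>?J. \<chi> j (inv\<^bsub>G\<^esub> y) \<otimes> lin_ext (\<chi> j) a) = a y \<otimes> [N] \<cdot> \<one>"
    if a: "a \<in> carrier FG" and y: "y \<in> carrier G" for a y
  proof -
    have "(\<Oplus>j\<in>?J. \<chi> j (inv\<^bsub>G\<^esub> y) \<otimes> lin_ext (\<chi> j) a)
        = (\<Oplus>j\<in>?J. \<Oplus>x\<in>carrier G. \<chi> j (inv\<^bsub>G\<^esub> y) \<otimes> (a x \<otimes> \<chi> j x))"
      unfolding lin_ext_def using a y \<chi>
      by (intro finsum_cong' refl finsum_rdistr finite_G) (auto intro!: finsum_closed)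
    also have "\<dots> = (\<Oplus>x\<in>carrier G. \<Oplus>j\<in>?J. \<chi> j (inv\<^bsub>G\<^esub> y) \<otimes> (a x \<otimes> \<chi> j x))"
      using a y \<chi> by (intro finsum_swap finite_G) auto
    also have "\<dots> = (\<Oplus>x\<in>carrier G. if x = y then a x \<otimes> [N] \<cdot> \<one> else \<zero>)"
    proof (intro finsum_cong' refl)
      fix x assume x: "x \<in> carrier G"
      have "(\<Oplus>j\<in>?J. \<chi> j (inv\<^bsub>G\<^esub> y) \<otimes> (a x \<otimes> \<chi> j x))
          = (\<Oplus>j\<in>?J. a x \<otimes> \<chi> j (inv\<^bsub>G\<^esub> y \<otimes>\<^bsub>G\<^esub> x))"
        using a x y \<chi> by (intro finsum_cong' refl) (auto simp: \<chi>_mult m_lcomm)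
      also have "\<dots> = a x \<otimes> (\<Oplus>j\<in>?J. \<chi> j (inv\<^bsub>G\<^esub> y \<otimes>\<^bsub>G\<^esub> x))"
        using a x y \<chi> by (intro finsum_rdistr[symmetric]) auto
      also have "\<dots> = (if x = y then a x \<otimes> [N] \<cdot> \<one> else \<zero>)"
      proof (cases "x = y")
        case True
        have "(\<Oplus>j\<in>?J. \<chi> j \<one>\<^bsub>G\<^esub>) = (\<Oplus>j\<in>?J. \<one>)"
          using \<chi>_one by (intro finsum_cong' refl) auto
        also have "\<dots> = [N] \<cdot> \<one>"
          by (simp add: add.finprod_const)
        finally show ?thesis
          using True y by simp
      next
        case False
        then have "inv\<^bsub>G\<^esub> y \<otimes>\<^bsub>G\<^esub> x \<noteq> \<one>\<^bsub>G\<^esub>"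
          using x y by (metis G.inv_closed G.inv_equality G.inv_inv)
        then show ?thesis
          using False a x y by (simp add: orth)
      qed
      finally show "(\<Oplus>j\<in>?J. \<chi> j (inv\<^bsub>G\<^esub> y) \<otimes> (a x \<otimes> \<chi> j x))
          = (if x = y then a x \<otimes> [N] \<cdot> \<one> else \<zero>)" .
    qed (use a in auto)
    also have "\<dots> = a y \<otimes> [N] \<cdot> \<one>"
      using a by (intro add.finprod_singleton_swap[OF y finite_G]) auto
    finally show ?thesis .
  qed
  have inj: "inj_on \<Phi> (carrier FG)"
  proof (rule inj_onI)
    fix a b assume ab: "a \<in> carrier FG" "b \<in> carrier FG" and "\<Phi> a = \<Phi> b"
    then have eq: "lin_ext (\<chi> j) a = lin_ext (\<chi> j) b" if "j < N" for j
      using that by (metis \<Phi>_def lessThan_iff restrict_apply')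
    show "a = b"
    proof (rule FG_ext[OF ab])
      fix y assume y: "y \<in> carrier G"
      have "(\<Oplus>j\<in>?J. \<chi> j (inv\<^bsub>G\<^esub> y) \<otimes> lin_ext (\<chi> j) a)
          = (\<Oplus>j\<in>?J. \<chi> j (inv\<^bsub>G\<^esub> y) \<otimes> lin_ext (\<chi> j) b)"
        using ab y \<chi> closed by (intro finsum_cong' refl) (auto simp: eq)
      then have "[N] \<cdot> \<one> \<otimes> a y = [N] \<cdot> \<one> \<otimes> b y"
        using ab y by (simp add: inversion m_comm)
      then show "a y = b y"
        using ab y unit by (simp add: Units_l_cancel)
    qed
  qed
  have \<Phi>_closed: "\<Phi> ` carrier FG \<subseteq> ?J \<rightarrow>\<^sub>E carrier R"
    using closed by (auto simp: \<Phi>_def split: if_splits)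
  \<comment> \<open>There are as many characters as group elements, so source and target both have
    |R|^N elements.\<close>
  have "card (\<Phi> ` carrier FG) = card (?J \<rightarrow>\<^sub>E carrier R)"
    unfolding card_image[OF inj] using finite_G by (simp add: carrier_FG card_PiE N order_def)
  with \<Phi>_closed have surj: "\<Phi> ` carrier FG = ?J \<rightarrow>\<^sub>E carrier R"
    using finR by (intro card_subset_eq finite_PiE) auto
  \<comment> \<open>Surjectivity supplies \<open>b\<close> with the inverse character values;
    injectivity then lifts the equations for character values to ab = ba = 1.\<close>
  have unitI: "a \<in> Units FG" if a: "a \<in> carrier FG" and u: "\<And>j. j < N \<Longrightarrow> \<Phi> a j \<in> Units R" for a
  proof -
    have "(\<lambda>j\<in>?J. inv \<Phi> a j) \<in> \<Phi> ` carrier FG"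
      unfolding surj using u by auto
    then obtain b where b: "b \<in> carrier FG" and "(\<lambda>j\<in>?J. inv \<Phi> a j) = \<Phi> b"
      by auto
    then have bj: "lin_ext (\<chi> j) b = inv (lin_ext (\<chi> j) a)" if "j < N" for j
      using that by (metis \<Phi>_def lessThan_iff restrict_apply')
    have u': "lin_ext (\<chi> j) a \<in> Units R" if "j < N" for j
      using u[OF that] that by (simp add: \<Phi>_def)
    have "\<Phi> (a \<otimes>\<^bsub>FG\<^esub> b) = \<Phi> \<one>\<^bsub>FG\<^esub>" "\<Phi> (b \<otimes>\<^bsub>FG\<^esub> a) = \<Phi> \<one>\<^bsub>FG\<^esub>"
      unfolding \<Phi>_def using a b u' by (auto simp: mult one bj intro!: restrict_ext)
    then have "a \<otimes>\<^bsub>FG\<^esub> b = \<one>\<^bsub>FG\<^esub>" "b \<otimes>\<^bsub>FG\<^esub> a = \<one>\<^bsub>FG\<^esub>"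
      using a b inj by (auto dest: inj_onD)
    then show ?thesis
      using a b unfolding Units_def by blast
  qed
  have unitD: "\<Phi> a j \<in> Units R" if a: "a \<in> Units FG" and j: "j < N" for a j
  proof -
    obtain b where ab: "a \<in> carrier FG" "b \<in> carrier FG"
      "b \<otimes>\<^bsub>FG\<^esub> a = \<one>\<^bsub>FG\<^esub>" "a \<otimes>\<^bsub>FG\<^esub> b = \<one>\<^bsub>FG\<^esub>"
      using a by (auto simp: Units_def)
    then have "lin_ext (\<chi> j) b \<otimes> lin_ext (\<chi> j) a = \<one>" "lin_ext (\<chi> j) a \<otimes> lin_ext (\<chi> j) b = \<one>"
      using j by (simp_all add: one flip: mult)
    then show ?thesis
      using ab closed[of _ j] j unfolding Units_def by (auto simp: \<Phi>_def)
  qed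
  have sub: "Units FG \<subseteq> carrier FG"
    by (auto simp: Units_def)
  have "\<Phi> ` Units FG = ?J \<rightarrow>\<^sub>E Units R"
  proof
    show "\<Phi> ` Units FG \<subseteq> ?J \<rightarrow>\<^sub>E Units R"
      using unitD by (auto simp: \<Phi>_def split: if_splits)
    show "?J \<rightarrow>\<^sub>E Units R \<subseteq> \<Phi> ` Units FG"
    proof
      fix f assume f: "f \<in> ?J \<rightarrow>\<^sub>E Units R"
      then have "f \<in> \<Phi> ` carrier FG"
        unfolding surj by (auto simp: PiE_iff)
      then show "f \<in> \<Phi> ` Units FG"
        using f unitI by (auto simp: PiE_iff)
    qed
  qed
  then have bij: "bij_betw \<Phi> (Units FG) (?J \<rightarrow>\<^sub>E Units R)"
    using inj_on_subset[OF inj sub] by (simp add: bij_betw_def)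
  show ?thesis
  proof (rule is_isoI_bij)
    show "\<Phi> \<in> hom (units_of FG) (product_group ?J (\<lambda>_. units_of R))"
    proof (rule homI)
      show "\<Phi> a \<in> carrier (product_group ?J (\<lambda>_. units_of R))" if "a \<in> carrier (units_of FG)" for a
        using that bij by (auto simp: units_of_carrier bij_betw_def)
      show "\<Phi> (a \<otimes>\<^bsub>units_of FG\<^esub> b) = \<Phi> a \<otimes>\<^bsub>product_group ?J (\<lambda>_. units_of R)\<^esub> \<Phi> b"
        if "a \<in> carrier (units_of FG)" "b \<in> carrier (units_of FG)" for a b
        using that sub by (auto simp: units_of_carrier units_of_mult \<Phi>_def mult subset_iff
            intro!: restrict_ext)
    qed
    show "bij_betw \<Phi> (carrier (units_of FG)) (carrier (product_group ?J (\<lambda>_. units_of R)))"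
      using bij by (simp add: units_of_carrier)
  qed
qed

end

section \<open>Sign characters of C_2^k and their orthogonality\<close>

text \<open>|A| + |B| counts the intersection twice, which does not affect parity.\<close>

lemma even_card_sym_diff:
  assumes "finite A" "finite B"
  shows "even (card (sym_diff A B)) \<longleftrightarrow> even (card A) = even (card B)"
proof -
  have "card A = card (A - B) + card (A \<inter> B)" "card B = card (B - A) + card (A \<inter> B)"
    using assms by (simp_all add: card_Diff_subset_Int card_mono Int_commute)
  moreover have "card (sym_diff A B) = card (A - B) + card (B - A)"
    using assms by (intro card_Un_disjoint) auto
  ultimately show ?thesis
    by auto
qed

text \<open>This is x -> (-1)^(sum of x_i over i in S), with the power replaced by a parity
  test.\<close>

definition sign_char :: "('a, 'm) ring_scheme \<Rightarrow> nat set \<Rightarrow> (nat \<Rightarrow> int) \<Rightarrow> 'a" where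
  "sign_char R S x = (if even (card {i \<in> S. x i = 1}) then \<one>\<^bsub>R\<^esub> else \<ominus>\<^bsub>R\<^esub> \<one>\<^bsub>R\<^esub>)"

lemma cyclic_power_2_mem:
  "\<lbrakk>x \<in> carrier (cyclic_power 2 k); i < k\<rbrakk> \<Longrightarrow> x i = 0 \<or> x i = 1"
  by (force simp: carrier_cyclic_power PiE_iff)

context ring begin

lemma sign_char_closed [simp]: "sign_char R S x \<in> carrier R"
  by (simp add: sign_char_def)

lemma sign_char_one: "S \<subseteq> {..<k} \<Longrightarrow> sign_char R S \<one>\<^bsub>cyclic_power 2 k\<^esub> = \<one>"
proof -
  assume "S \<subseteq> {..<k}"
  then have "{i \<in> S. \<one>\<^bsub>cyclic_power 2 k\<^esub> i = 1} = {}"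
    by (auto simp: one_cyclic_power)
  then show ?thesis
    unfolding sign_char_def by (simp only:) simp
qed

text \<open>Addition modulo 2 takes the symmetric difference of the sets of coordinates equal to 1,
  and parity is additive under it.\<close>

lemma sign_char_mult:
  assumes S: "S \<subseteq> {..<k}" and x: "x \<in> carrier (cyclic_power 2 k)" and y: "y \<in> carrier (cyclic_power 2 k)"
  shows "sign_char R S (x \<otimes>\<^bsub>cyclic_power 2 k\<^esub> y) = sign_char R S x \<otimes> sign_char R S y"
proof -
  have "(x \<otimes>\<^bsub>cyclic_power 2 k\<^esub> y) i = 1 \<longleftrightarrow> (x i = 1) \<noteq> (y i = 1)" if "i \<in> S" for i
    using S that cyclic_power_2_mem[OF x, of i] cyclic_power_2_mem[OF y, of i]
    by (auto simp: mult_cyclic_power)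
  then have "{i \<in> S. (x \<otimes>\<^bsub>cyclic_power 2 k\<^esub> y) i = 1} = sym_diff {i \<in> S. x i = 1} {i \<in> S. y i = 1}"
    by auto
  moreover have "finite S"
    using S finite_subset by blast
  ultimately show ?thesis
    by (simp add: sign_char_def even_card_sym_diff l_minus)
qed

lemma sign_char_flip:
  assumes "finite S" "x i = 1"
  shows "sign_char R (sym_diff S {i}) x = \<ominus> sign_char R S x"
proof -
  have "{j \<in> sym_diff S {i}. x j = 1} = sym_diff {j \<in> S. x j = 1} {i}"
    using assms by auto
  then show ?thesis
    using assms by (simp add: sign_char_def even_card_sym_diff)
qed

end

text \<open>Choose i with x_i = 1. Toggling i in S permutes the subsets and negates every term, so
  the sum T satisfies T = -T; as 2 is nonzero in a domain, T = 0.\<close>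

lemma (in domain) sign_char_sum:
  assumes two: "\<one> \<oplus> \<one> \<noteq> \<zero>" and x: "x \<in> carrier (cyclic_power 2 k)"
    and ne: "x \<noteq> \<one>\<^bsub>cyclic_power 2 k\<^esub>"
  shows "(\<Oplus>S\<in>Pow {..<k}. sign_char R S x) = \<zero>"
proof -
  have "\<exists>i<k. x i \<noteq> 0"
  proof (rule ccontr)
    assume "\<not> (\<exists>i<k. x i \<noteq> 0)"
    then have "x = \<one>\<^bsub>cyclic_power 2 k\<^esub>"
      using x by (intro PiE_ext[of x "{..<k}" "\<lambda>_. {0..<2}"])
        (auto simp: one_cyclic_power carrier_cyclic_power)
    then show False using ne by simp
  qed
  then obtain i where i: "i < k" "x i = 1"
    using cyclic_power_2_mem[OF x] by blast
  let ?T = "\<Oplus>S\<in>Pow {..<k}. sign_char R S x" and ?\<sigma> = "\<lambda>S. sym_diff S {i}"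
  have T: "?T \<in> carrier R"
    by (rule finsum_closed) simp
  have "bij_betw ?\<sigma> (Pow {..<k}) (Pow {..<k})"
    by (rule bij_betw_byWitness[where f' = ?\<sigma>]) (use i in auto)
  then have "?T = (\<Oplus>S\<in>Pow {..<k}. sign_char R (?\<sigma> S) x)"
    by (intro finsum_bij_betw[symmetric]) simp_all
  also have "\<dots> = (\<Oplus>S\<in>Pow {..<k}. (\<ominus> \<one>) \<otimes> sign_char R S x)"
    using i by (intro finsum_cong' refl) (auto simp: sign_char_flip finite_subset l_minus)
  also have "\<dots> = \<ominus> \<one> \<otimes> ?T"
    by (intro finsum_rdistr[symmetric]) auto
  finally have "?T = \<ominus> ?T"
    using T by (simp add: l_minus)
  then have "?T \<oplus> ?T = \<zero>"
    using T by (metis r_neg)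
  then have "(\<one> \<oplus> \<one>) \<otimes> ?T = \<zero>"
    using T by (simp add: l_distr)
  then show ?thesis
    using two T by (simp add: integral_iff)
qed

lemma (in domain) two_power_neq_zero:
  assumes "\<one> \<oplus> \<one> \<noteq> \<zero>"
  shows "add_pow R ((2::nat) ^ k) \<one> \<noteq> \<zero>"
proof (induction k)
  case 0
  then show ?case by simp
next
  case (Suc k)
  have "add_pow R ((2::nat) ^ Suc k) \<one> = add_pow R ((2::nat) ^ k) \<one> \<oplus> add_pow R ((2::nat) ^ k) \<one>"
    by (simp add: add.nat_pow_mult mult_2)
  also have "\<dots> = (\<one> \<oplus> \<one>) \<otimes> add_pow R ((2::nat) ^ k) \<one>"
    by (simp add: l_distr)
  finally show ?case
    using Suc assms by (simp add: integral_iff)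
qed

lemma units_group_algebra_cyclic_power_2_odd:
  assumes "field F" and fin: "finite (carrier F)" and two: "\<one>\<^bsub>F\<^esub> \<oplus>\<^bsub>F\<^esub> \<one>\<^bsub>F\<^esub> \<noteq> \<zero>\<^bsub>F\<^esub>"
  shows "units_of (group_algebra F (cyclic_power 2 k)) \<cong> cyclic_power (order F - 1) (2 ^ k)"
proof -
  let ?C = "cyclic_power 2 k"
  interpret field F by fact
  interpret finite_group_algebra F ?C
    by (intro finite_group_algebra.intro finite_group_algebra_axioms.intro)
      (simp_all add: cring_axioms group_cyclic_power finite_cyclic_power)
  \<comment> \<open>Characters are naturally indexed by subsets, but \<open>cyclic_power\<close> by
    the numbers below 2^k; any enumeration of the subsets connects the two.\<close>
  obtain S where S: "bij_betw S {..<(2::nat) ^ k} (Pow {..<k})"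
    using ex_bij_betw_nat_finite[of "Pow {..<k}"] by (auto simp: card_Pow atLeast0LessThan)
  then have Sk: "S j \<subseteq> {..<k}" if "j < 2 ^ k" for j
    using that by (auto simp: bij_betw_def)
  have "units_of (group_algebra F ?C) \<cong> product_group {..<(2::nat) ^ k} (\<lambda>_. units_of F)"
  proof (rule units_iso_product_of_characters[where \<chi> = "\<lambda>j. sign_char F (S j)"])
    show "finite (carrier F)" by fact
    show "(2::nat) ^ k = order ?C"
      by (simp add: order_cyclic_power)
    show "add_pow F ((2::nat) ^ k) \<one>\<^bsub>F\<^esub> \<in> Units F"
      using two_power_neq_zero[OF two] by (simp add: field_Units)
    show "(\<Oplus>\<^bsub>F\<^esub>j\<in>{..<2 ^ k}. sign_char F (S j) x) = \<zero>\<^bsub>F\<^esub>"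
      if "x \<in> carrier ?C" "x \<noteq> \<one>\<^bsub>?C\<^esub>" for x
      using finsum_bij_betw[OF S, of "\<lambda>S. sign_char F S x"] sign_char_sum[OF two that] by simp
  qed (use Sk in \<open>simp_all add: sign_char_mult sign_char_one\<close>)
  also have "\<dots> \<cong> cyclic_power (order F - 1) (2 ^ k)"
    unfolding cyclic_power_def by (intro product_group_iso units_iso_integer_mod_group fin)
  finally show ?thesis .
qed

subsection \<open>Characteristic two\<close>

text \<open>An involution without fixed points splits A into pairs with cancelling terms. The
  induction removes one whole pair at a time, so the rest is still stable under the
  involution.\<close>

lemma (in abelian_monoid) finsum_involution_cancel:
  assumes "finite A" and f: "\<And>x. x \<in> A \<Longrightarrow> f x \<in> carrier G"
    and \<sigma>: "\<And>x. x \<in> A \<Longrightarrow> \<sigma> x \<in> A \<and> \<sigma> x \<noteq> x \<and> \<sigma> (\<sigma> x) = x \<and> f x \<oplus> f (\<sigma> x) = \<zero>"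
  shows "(\<Oplus>x\<in>A. f x) = \<zero>"
  using assms
proof (induction A rule: finite_psubset_induct)
  case (psubset A)
  show ?case
  proof (cases "A = {}")
    case False
    then obtain x where x: "x \<in> A" by blast
    let ?B = "A - {x, \<sigma> x}"
    have "(\<Oplus>x\<in>?B. f x) = \<zero>"
    proof (rule psubset.IH)
      show "?B \<subset> A"
        using x by blast
      show "\<sigma> y \<in> ?B \<and> \<sigma> y \<noteq> y \<and> \<sigma> (\<sigma> y) = y \<and> f y \<oplus> f (\<sigma> y) = \<zero>" if "y \<in> ?B" for y
        using that psubset.prems(2)[of y] psubset.prems(2)[OF x] by auto
    qed (use psubset.prems in auto)
    moreover have "A = insert x (insert (\<sigma> x) ?B)"
      using x psubset.prems(2)[OF x] by auto
    moreover have "(\<Oplus>x\<in>insert x (insert (\<sigma> x) ?B). f x) = f x \<oplus> (f (\<sigma> x) \<oplus> (\<Oplus>x\<in>?B. f x))"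
      using x psubset.prems(2)[OF x] psubset.hyps psubset.prems(1)
      by (subst finsum_insert, auto)+
    ultimately show ?thesis
      using x psubset.prems(2)[OF x] psubset.prems(1) by simp
  qed simp
qed

locale char_two_elementary_group_algebra = finite_group_algebra R G + field R
  for R (structure) and G +
  assumes char_two: "\<one> \<oplus> \<one> = \<zero>"
    and exponent_two: "\<And>x. x \<in> carrier G \<Longrightarrow> x \<otimes>\<^bsub>G\<^esub> x = \<one>\<^bsub>G\<^esub>"
begin

lemma double_eq_zero: "c \<in> carrier R \<Longrightarrow> c \<oplus> c = \<zero>"
  using l_distr[of \<one> \<one> c] char_two by simp

lemma aug_mult:
  "\<lbrakk>a \<in> carrier FG; b \<in> carrier FG\<rbrakk> \<Longrightarrow> aug (a \<otimes>\<^bsub>FG\<^esub> b) = aug a \<otimes> aug b"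
  by (rule lin_ext_mult) simp_all

lemma aug_one: "aug \<one>\<^bsub>FG\<^esub> = \<one>"
  by (simp add: lin_ext_one)

lemma aug_smult: "\<lbrakk>c \<in> carrier R; a \<in> carrier FG\<rbrakk> \<Longrightarrow> aug (c \<odot>\<^bsub>FG\<^esub> a) = c \<otimes> aug a"
  by (simp add: lin_ext_smult)

lemma aug_closed [simp]: "a \<in> carrier FG \<Longrightarrow> aug a \<in> carrier R"
  by simp

text \<open>Off the identity, the terms for \<open>g\<close> and \<open>g x\<close> in the square of \<open>a\<close> coincide and cancel;
  the remaining coefficient is found by applying the augmentation.\<close>

lemma square_FG:
  assumes a: "a \<in> carrier FG"
  shows "a \<otimes>\<^bsub>FG\<^esub> a = (aug a \<otimes> aug a) \<odot>\<^bsub>FG\<^esub> \<one>\<^bsub>FG\<^esub>"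
proof -
  have inv: "inv\<^bsub>G\<^esub> x = x" if "x \<in> carrier G" for x
    by (rule G.inv_equality) (use that exponent_two in simp_all)
  have off: "(a \<otimes>\<^bsub>FG\<^esub> a) x = \<zero>" if x: "x \<in> carrier G" "x \<noteq> \<one>\<^bsub>G\<^esub>" for x
  proof -
    have "(a \<otimes>\<^bsub>FG\<^esub> a) x = (\<Oplus>g\<in>carrier G. a g \<otimes> a (g \<otimes>\<^bsub>G\<^esub> x))"
      using a x by (simp add: mult_FG) (auto simp: inv intro!: finsum_cong')
    \<comment> \<open>Translation by \<open>x\<close> is an involution because x x = 1, and has no
      fixed point because \<open>x\<close> is not the identity.\<close>
    also have "\<dots> = \<zero>"
    proof (rule finsum_involution_cancel[where \<sigma> = "\<lambda>g. g \<otimes>\<^bsub>G\<^esub> x", OF finite_G])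
      fix g assume g: "g \<in> carrier G"
      then show "a g \<otimes> a (g \<otimes>\<^bsub>G\<^esub> x) \<in> carrier R"
        using a x by simp
      have gxx: "g \<otimes>\<^bsub>G\<^esub> x \<otimes>\<^bsub>G\<^esub> x = g"
        using g x by (simp add: G.m_assoc exponent_two)
      show "g \<otimes>\<^bsub>G\<^esub> x \<in> carrier G \<and> g \<otimes>\<^bsub>G\<^esub> x \<noteq> g \<and> g \<otimes>\<^bsub>G\<^esub> x \<otimes>\<^bsub>G\<^esub> x = g \<and>
          a g \<otimes> a (g \<otimes>\<^bsub>G\<^esub> x) \<oplus> a (g \<otimes>\<^bsub>G\<^esub> x) \<otimes> a (g \<otimes>\<^bsub>G\<^esub> x \<otimes>\<^bsub>G\<^esub> x) = \<zero>"
        using a g x by (simp add: gxx m_comm[of "a (g \<otimes>\<^bsub>G\<^esub> x)"] double_eq_zero)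
    qed
    finally show ?thesis .
  qed
  define c where "c = (a \<otimes>\<^bsub>FG\<^esub> a) \<one>\<^bsub>G\<^esub>"
  have c: "c \<in> carrier R"
    using a by (simp add: c_def)
  have eq: "a \<otimes>\<^bsub>FG\<^esub> a = c \<odot>\<^bsub>FG\<^esub> \<one>\<^bsub>FG\<^esub>"
    by (rule FG_ext) (use a c off in \<open>auto simp: smult_FG one_FG c_def\<close>)
  have "aug a \<otimes> aug a = aug (a \<otimes>\<^bsub>FG\<^esub> a)"
    using a by (simp add: aug_mult)
  also have "\<dots> = c"
    unfolding eq using c by (simp add: aug_smult aug_one)
  finally show ?thesis
    using eq by simp
qed

text \<open>The square formula exhibits the inverse of a as e(a)^-2 a. Conversely, the augmentation
  respects products, so it sends a unit to a nonzero element.\<close>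

lemma Units_FG: "Units FG = {a \<in> carrier FG. aug a \<noteq> \<zero>}"
proof (intro equalityI subsetI)
  fix a assume "a \<in> Units FG"
  then obtain b where ab: "a \<in> carrier FG" "b \<in> carrier FG" "a \<otimes>\<^bsub>FG\<^esub> b = \<one>\<^bsub>FG\<^esub>"
    by (auto simp: Units_def)
  then have "aug a \<otimes> aug b = \<one>"
    by (simp add: aug_one flip: aug_mult)
  then have "aug a \<noteq> \<zero>"
    using ab by (metis aug_closed l_null one_not_zero)
  then show "a \<in> {a \<in> carrier FG. aug a \<noteq> \<zero>}"
    using ab by simp
next
  fix a assume "a \<in> {a \<in> carrier FG. aug a \<noteq> \<zero>}"
  then have a: "a \<in> carrier FG" "aug a \<noteq> \<zero>" by auto
  define c where "c = inv (aug a \<otimes> aug a)"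
  have "aug a \<otimes> aug a \<in> Units R"
    using a by (simp add: field_Units integral_iff)
  then have c: "c \<in> carrier R" "c \<otimes> (aug a \<otimes> aug a) = \<one>"
    unfolding c_def by simp_all
  have "c \<odot>\<^bsub>FG\<^esub> (a \<otimes>\<^bsub>FG\<^esub> a) = \<one>\<^bsub>FG\<^esub>"
    using a c by (simp add: square_FG smult_smult_FG smult_one_FG)
  then show "a \<in> Units FG"
    using a c unfolding Units_def by (auto simp: smult_mult_FG intro!: bexI[of _ "c \<odot>\<^bsub>FG\<^esub> a"])
qed

text \<open>The group of normalized units, that is, the units of augmentation 1.\<close>

definition V where
  "V = FG\<lparr>carrier := {a \<in> carrier FG. aug a = \<one>}\<rparr>"

lemma carrier_V: "carrier V = {a \<in> carrier FG. aug a = \<one>}"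
  and mult_V [simp]: "a \<otimes>\<^bsub>V\<^esub> b = a \<otimes>\<^bsub>FG\<^esub> b"
  and one_V [simp]: "\<one>\<^bsub>V\<^esub> = \<one>\<^bsub>FG\<^esub>"
  by (simp_all add: V_def)

lemma square_V: "a \<in> carrier V \<Longrightarrow> a \<otimes>\<^bsub>V\<^esub> a = \<one>\<^bsub>V\<^esub>"
  by (simp add: carrier_V square_FG smult_one_FG)

lemma group_V: "group V"
proof (rule groupI)
  show "\<exists>b\<in>carrier V. b \<otimes>\<^bsub>V\<^esub> a = \<one>\<^bsub>V\<^esub>" if "a \<in> carrier V" for a
    using square_V[OF that] that by blast
qed (auto simp: carrier_V aug_mult aug_one assoc_FG l_one_FG)

text \<open>The coefficient at the identity is determined by the others.\<close>

lemma card_V: "card (carrier V) = card (carrier R) ^ (order G - 1)"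
proof -
  let ?H = "carrier G - {\<one>\<^bsub>G\<^esub>}"
  let ?e = "\<lambda>b. \<lambda>x\<in>carrier G. if x = \<one>\<^bsub>G\<^esub> then \<one> \<ominus> (\<Oplus>y\<in>?H. b y) else b x"
  have aug: "aug a = a \<one>\<^bsub>G\<^esub> \<oplus> (\<Oplus>y\<in>?H. a y)" if "a \<in> carrier FG" for a
  proof -
    have "aug a = (\<Oplus>x\<in>insert \<one>\<^bsub>G\<^esub> ?H. a x)"
      unfolding lin_ext_def using that by (intro finsum_cong') auto
    then show ?thesis
      using that finite_G by (subst (asm) finsum_insert) auto
  qed
  have "bij_betw (\<lambda>a. restrict a ?H) (carrier V) (?H \<rightarrow>\<^sub>E carrier R)"
  proof (rule bij_betw_byWitness[where f' = ?e])
    have sum_restrict: "(\<Oplus>y\<in>?H. restrict a ?H y) = (\<Oplus>y\<in>?H. a y)" if "a \<in> carrier FG" for a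
      using that by (intro finsum_cong') auto
    have sum_e: "(\<Oplus>y\<in>?H. ?e b y) = (\<Oplus>y\<in>?H. b y)" if "b \<in> ?H \<rightarrow>\<^sub>E carrier R" for b
      using that by (intro finsum_cong') auto
    have sum_closed: "(\<Oplus>y\<in>?H. b y) \<in> carrier R" if "b \<in> ?H \<rightarrow>\<^sub>E carrier R" for b
      using that by (intro finsum_closed) auto
    show "\<forall>a\<in>carrier V. ?e (restrict a ?H) = a"
    proof
      fix a assume "a \<in> carrier V"
      then have a: "a \<in> carrier FG" and "a \<one>\<^bsub>G\<^esub> \<oplus> (\<Oplus>y\<in>?H. a y) = \<one>"
        by (auto simp: carrier_V aug)
      moreover have s: "(\<Oplus>y\<in>?H. a y) \<in> carrier R"
        using a by (intro finsum_closed) auto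
      ultimately have "\<one> \<ominus> (\<Oplus>y\<in>?H. a y) = a \<one>\<^bsub>G\<^esub>"
        by (metis FG_closed G.one_closed add.inv_solve_right' a_minus_def one_closed)
      then show "?e (restrict a ?H) = a"
        using a by (auto simp: sum_restrict carrier_FG PiE_iff extensional_def fun_eq_iff)
    qed
    show "\<forall>b\<in>?H \<rightarrow>\<^sub>E carrier R. restrict (?e b) ?H = b"
      by (auto simp: PiE_iff extensional_def fun_eq_iff)
    show "(\<lambda>a. restrict a ?H) ` carrier V \<subseteq> ?H \<rightarrow>\<^sub>E carrier R"
      by (auto simp: carrier_V split: if_splits)
    show "?e ` (?H \<rightarrow>\<^sub>E carrier R) \<subseteq> carrier V"
    proof clarify
      fix b assume b: "b \<in> ?H \<rightarrow>\<^sub>E carrier R"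
      have e: "?e b \<in> carrier FG"
        unfolding carrier_FG using b sum_closed[OF b] by (auto simp: PiE_iff)
      have "aug (?e b) = \<one> \<ominus> (\<Oplus>y\<in>?H. b y) \<oplus> (\<Oplus>y\<in>?H. b y)"
        unfolding aug[OF e] sum_e[OF b] by simp
      also have "\<dots> = \<one>"
        using sum_closed[OF b] by (simp add: a_minus_def a_assoc l_neg)
      finally show "?e b \<in> carrier V"
        using e by (simp add: carrier_V)
    qed
  qed
  then have "card (carrier V) = card (?H \<rightarrow>\<^sub>E carrier R)"
    by (rule bij_betw_same_card)
  also have "\<dots> = card (carrier R) ^ (order G - 1)"
    using finite_G by (simp add: card_PiE order_def)
  finally show ?thesis .
qed

text \<open>If e(v) = 1, then cv has augmentation c, so the pair (v, c) can be read back from cv.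
  Scalars move past products in FG, which makes the decomposition multiplicative.\<close>

lemma units_iso_V: "units_of FG \<cong> V \<times>\<times> units_of R"
proof (rule is_isoI_bij)
  let ?h = "\<lambda>a. (inv (aug a) \<odot>\<^bsub>FG\<^esub> a, aug a)"
  have unit: "aug a \<in> Units R" if "a \<in> Units FG" for a
    using that by (simp add: Units_FG field_Units)
  show "?h \<in> hom (units_of FG) (V \<times>\<times> units_of R)"
  proof (rule homI)
    show "?h a \<in> carrier (V \<times>\<times> units_of R)" if "a \<in> carrier (units_of FG)" for a
    proof -
      have "a \<in> carrier FG" "aug a \<in> Units R"
        using that unit by (auto simp: units_of_carrier Units_FG)
      then show ?thesis
        by (simp add: units_of_carrier carrier_V aug_smult)
    qed
    show "?h (a \<otimes>\<^bsub>units_of FG\<^esub> b) = ?h a \<otimes>\<^bsub>V \<times>\<times> units_of R\<^esub> ?h b"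
      if "a \<in> carrier (units_of FG)" "b \<in> carrier (units_of FG)" for a b
    proof -
      have ab: "a \<in> carrier FG" "b \<in> carrier FG" "aug a \<in> Units R" "aug b \<in> Units R"
        using that unit by (auto simp: units_of_carrier Units_FG)
      have "inv (aug a \<otimes> aug b) = inv (aug a) \<otimes> inv (aug b)"
        using ab by (intro comm_inv_char) (simp_all add: m_ac flip: m_assoc)
      then show ?thesis
        using ab by (simp add: units_of_mult aug_mult smult_mult_FG smult_smult_FG m_comm)
    qed
  qed
  show "bij_betw ?h (carrier (units_of FG)) (carrier (V \<times>\<times> units_of R))"
  proof (rule bij_betw_byWitness[where f' = "\<lambda>(v, c). c \<odot>\<^bsub>FG\<^esub> v"])
    show "\<forall>a\<in>carrier (units_of FG). (\<lambda>(v, c). c \<odot>\<^bsub>FG\<^esub> v) (?h a) = a"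
    proof
      fix a assume "a \<in> carrier (units_of FG)"
      then have "a \<in> carrier FG" "aug a \<in> Units R"
        using unit by (auto simp: units_of_carrier Units_FG)
      then show "(\<lambda>(v, c). c \<odot>\<^bsub>FG\<^esub> v) (?h a) = a"
        by (simp add: smult_smult_FG smult_one_FG)
    qed
    show "?h ` carrier (units_of FG) \<subseteq> carrier (V \<times>\<times> units_of R)"
      using \<open>?h \<in> hom _ _\<close> by (auto simp: hom_def)
    show "\<forall>vc\<in>carrier (V \<times>\<times> units_of R). ?h ((\<lambda>(v, c). c \<odot>\<^bsub>FG\<^esub> v) vc) = vc"
      by (auto simp: carrier_V units_of_carrier aug_smult smult_smult_FG smult_one_FG Units_closed)
    show "(\<lambda>(v, c). c \<odot>\<^bsub>FG\<^esub> v) ` carrier (V \<times>\<times> units_of R) \<subseteq> carrier (units_of FG)"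
      by (auto simp: carrier_V units_of_carrier aug_smult Units_FG field_Units)
  qed
qed

end

lemma units_group_algebra_cyclic_power_2_even:
  assumes "field F" and ord: "order F = 2 ^ n" and two: "\<one>\<^bsub>F\<^esub> \<oplus>\<^bsub>F\<^esub> \<one>\<^bsub>F\<^esub> = \<zero>\<^bsub>F\<^esub>"
  shows "units_of (group_algebra F (cyclic_power 2 k))
      \<cong> cyclic_power 2 ((2 ^ k - 1) * n) \<times>\<times> integer_mod_group (2 ^ n - 1)"
proof -
  let ?C = "cyclic_power 2 k"
  interpret field F by fact
  interpret char_two_elementary_group_algebra F ?C
    by (intro char_two_elementary_group_algebra.intro finite_group_algebra.intro
        finite_group_algebra_axioms.intro char_two_elementary_group_algebra_axioms.intro)
      (simp_all add: cring_axioms field_axioms group_cyclic_power finite_cyclic_power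
        cyclic_power_2_square two)
  have fin: "finite (carrier F)"
    using ord order_gt_0_iff_finite by fastforce
  \<comment> \<open>The count of V is (2^n)^(2^k - 1); its exponent of 2 becomes the rank, which is
    31n for k = 5.\<close>
  have "order V = 2 ^ ((2 ^ k - 1) * n)"
    using card_V ord by (simp add: order_def order_cyclic_power flip: power_mult)
      (simp add: order_cyclic_power[unfolded order_def] mult.commute)
  then have "V \<cong> cyclic_power 2 ((2 ^ k - 1) * n)"
    by (intro group.exponent_two_iso[OF group_V] square_V)
  moreover have "units_of F \<cong> integer_mod_group (2 ^ n - 1)"
    using units_iso_integer_mod_group[OF fin] ord by simp
  ultimately show ?thesis
    using iso_trans[OF units_iso_V] group.DirProd_iso_trans[OF group_V] by blast
qed

section \<open>The two cases for C_2^5\<close>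

theorem theorem3p7:
  fixes F :: "('a, 'm) ring_scheme" and p n q :: nat
  assumes "Factorial_Ring.prime p" and "n \<ge> 1"
    and "field F" and "finite (carrier F)" and "ring_char F = p"
    and "q = p ^ n" and "order F = q"
  shows "(p = 2 \<longrightarrow>
            units_of (group_algebra F (cyclic_power 2 5))
              \<cong> cyclic_power 2 (31 * n) \<times>\<times> integer_mod_group (2 ^ n - 1))
       \<and> (p \<noteq> 2 \<longrightarrow> [q = 1] (mod 2) \<longrightarrow>
            units_of (group_algebra F (cyclic_power 2 5))
              \<cong> cyclic_power (p ^ n - 1) 32)"
proof -
  interpret field F by fact
  let ?P = "\<lambda>k::nat. k > 0 \<and> [k] \<cdot>\<^bsub>F\<^esub> \<one>\<^bsub>F\<^esub> = \<zero>\<^bsub>F\<^esub>"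
  have two: "add_pow F (2::nat) \<one>\<^bsub>F\<^esub> = \<one>\<^bsub>F\<^esub> \<oplus>\<^bsub>F\<^esub> \<one>\<^bsub>F\<^esub>"
    by (simp add: numeral_2_eq_2)
  have "p > 1"
    using assms(1) prime_gt_1_nat by blast
  \<comment> \<open>Since p > 1, \<open>ring_char\<close> is not at its default value 0, so p is
    genuinely the least positive multiple of 1 that vanishes.\<close>
  then have ex: "\<exists>k. ?P k" and least: "p = (LEAST k. ?P k)"
    using assms(5) by (auto simp: ring_char_def split: if_splits)
  show ?thesis
  proof (intro conjI impI)
    assume "p = 2"
    with LeastI_ex[OF ex] least have "\<one>\<^bsub>F\<^esub> \<oplus>\<^bsub>F\<^esub> \<one>\<^bsub>F\<^esub> = \<zero>\<^bsub>F\<^esub>"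
      by (simp flip: two)
    with units_group_algebra_cyclic_power_2_even[OF \<open>field F\<close>, of n 5]
    show "units_of (group_algebra F (cyclic_power 2 5))
        \<cong> cyclic_power 2 (31 * n) \<times>\<times> integer_mod_group (2 ^ n - 1)"
      using assms \<open>p = 2\<close> by simp
  next
    assume "p \<noteq> 2"
    \<comment> \<open>Here 2 < p, so minimality of p shows that 1 + 1 is nonzero.\<close>
    with \<open>p > 1\<close> have "\<not> ?P 2"
      using not_less_Least[of 2 ?P] least by auto
    then have "\<one>\<^bsub>F\<^esub> \<oplus>\<^bsub>F\<^esub> \<one>\<^bsub>F\<^esub> \<noteq> \<zero>\<^bsub>F\<^esub>"
      by (simp add: two)
    with units_group_algebra_cyclic_power_2_odd[OF \<open>field F\<close>, of 5]
    show "units_of (group_algebra F (cyclic_power 2 5)) \<cong> cyclic_power (p ^ n - 1) 32"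
      using assms by simp
  qed
qed

end
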